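(* Let $\mathbb{F}_q$ be a finite field with $q$ elements and characteristic $p$, let $n,m,k,\ell$ be positive integers, and let $r=p^\ell$. Then $$|\mathcal{P}_{(n,m,k),r}|=\min\left(q^{kn},\ \sum_{j=1}^m N_q(n,k,j)+1\right).$$
   Context: For positive integers $n,m,k,r$, the neuromanifold $\mathcal{P}_{(n,m,k),r}$ over $\mathbb{F}_q$ is the set of all $k$-tuples $(f_1,\dots,f_k)$ of homogeneous polynomials of degree $r$ in $\mathbb{F}_q[x_1,\dots,x_n]$ of the form $f_i=\sum_{s=1}^m b_{is}(a_{s1}x_1+\dots+a_{sn}x_n)^r$, $i=1,\dots,k$, with $(a_{st})\in\mathbb{F}_q^{m\times n}$ and $(b_{is})\in\mathbb{F}_q^{k\times m}$ arbitrary (equality is equality of polynomials). $N_q(n,k,j)$ is the number of $k\times n$ matrices of rank $j$ over $\mathbb{F}_q$, given by $$N_q(n,k,j)=\genfrac{[}{]}{0pt}{}{k}{j}_q(q^n-1)(q^n-q)\cdots(q^n-q^{j-1}),\qquad \genfrac{[}{]}{0pt}{}{a}{b}_q=\frac{(1-q^a)(1-q^{a-1})\cdots(1-q^{a-b+1})}{(1-q)(1-q^2)\cdots(1-q^b)}.$$ *)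

theory Defs
  imports
    "HOL-Computational_Algebra.Primes"
    "HOL-Library.Cardinality"
    "HOL-Library.Poly_Mapping"
    "Jordan_Normal_Form.DL_Rank"
begin

text \<open>
  Polynomials in the variables \<open>x\<^sub>0, x\<^sub>1, \<dots>\<close> are finitely supported maps from exponent
  vectors to coefficients; multiplication is the convolution product of
  \<^typ>\<open>('m::monoid_add) \<Rightarrow>\<^sub>0 ('a::semiring_0)\<close>.
\<close>

type_synonym 'a mpoly = "(nat \<Rightarrow>\<^sub>0 nat) \<Rightarrow>\<^sub>0 'a"

definition mconst :: "'a \<Rightarrow> 'a::comm_ring_1 mpoly"
  where "mconst c = Poly_Mapping.single 0 c"

definition mvar :: "nat \<Rightarrow> 'a::comm_ring_1 mpoly"
  where "mvar t = Poly_Mapping.single (Poly_Mapping.single t 1) 1"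

text \<open>
  All indices start at 0, so \<open>\<bbbF>\<^sub>q[x\<^sub>1, \<dots>, x\<^sub>n]\<close> is rendered by the variables \<open>x\<^sub>0, \<dots>, x\<^bsub>n-1\<^esub>\<close>,
  and a \<open>k\<close>-tuple of polynomials is a vector of dimension \<open>k\<close>.
\<close>

definition neuromanifold :: "nat \<Rightarrow> nat \<Rightarrow> nat \<Rightarrow> nat \<Rightarrow> 'a::comm_ring_1 mpoly vec set"
  where "neuromanifold n m k r =
    {vec k (\<lambda>i. \<Sum>s<m. mconst (B $$ (i, s)) * (\<Sum>t<n. mconst (A $$ (s, t)) * mvar t) ^ r) | A B.
      A \<in> carrier_mat m n \<and> B \<in> carrier_mat k m}"

text \<open>
  The exponents \<open>a - i\<close> are integers: for \<open>b > a\<close> the factor at \<open>i = a\<close> makes the numerator vanish.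
\<close>

definition gauss_binomial :: "nat \<Rightarrow> nat \<Rightarrow> nat \<Rightarrow> real"
  where "gauss_binomial q a b =
    (\<Prod>i<b. 1 - real q powi (int a - int i)) / (\<Prod>i=1..b. 1 - real q ^ i)"

definition num_rank_mats :: "nat \<Rightarrow> nat \<Rightarrow> nat \<Rightarrow> nat \<Rightarrow> real"
  where "num_rank_mats q n k j = gauss_binomial q k j * (\<Prod>i<j. real q ^ n - real q ^ i)"

lemma num_rank_mats_0: "num_rank_mats q n k 0 = 1"
  by (simp add: num_rank_mats_def gauss_binomial_def)

lemma num_rank_mats_dim_0: "num_rank_mats q 0 k (Suc j) = 0"
  unfolding num_rank_mats_def prod.lessThan_Suc_shift by simp

lemma num_rank_mats_Suc:
  assumes "q > 1"
  shows "num_rank_mats q (Suc n) k (Suc j) =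
    real q ^ Suc j * num_rank_mats q n k (Suc j) + (real q ^ k - real q ^ j) * num_rank_mats q n k j"
proof -
  let ?P = "\<lambda>j n. \<Prod>i<j. real q ^ n - real q ^ i"
  have q: "real q > 1" using assms by simp
  have P: "?P (Suc j) (Suc n) = (real q ^ Suc n - 1) * real q ^ j * ?P j n" for j n
    unfolding prod.lessThan_Suc_shift by (simp add: prod.distrib flip: right_diff_distrib)
  have ne: "1 - real q ^ Suc j \<noteq> 0"
    using one_less_power[OF q, of "Suc j"] by simp
  have g: "gauss_binomial q k (Suc j) * (1 - real q ^ Suc j) =
      gauss_binomial q k j * (1 - real q powi (int k - int j))"
    using ne by (simp add: gauss_binomial_def)
  have pw: "real q ^ j * real q powi (int k - int j) = real q ^ k"
    using q by (simp add: power_int_diff)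
  have "num_rank_mats q (Suc n) k (Suc j) - real q ^ Suc j * num_rank_mats q n k (Suc j)
     = gauss_binomial q k (Suc j) * (?P (Suc j) (Suc n) - real q ^ Suc j * ?P (Suc j) n)"
    by (simp add: num_rank_mats_def algebra_simps)
  also have "?P (Suc j) (Suc n) - real q ^ Suc j * ?P (Suc j) n
     = - (1 - real q ^ Suc j) * (real q ^ j * ?P j n)"
    unfolding P by (simp add: algebra_simps)
  also have "gauss_binomial q k (Suc j) * (- (1 - real q ^ Suc j) * (real q ^ j * ?P j n))
     = - (gauss_binomial q k (Suc j) * (1 - real q ^ Suc j)) * (real q ^ j * ?P j n)"
    by (simp only: minus_mult_left minus_mult_right mult.assoc)
  also have "\<dots> = gauss_binomial q k j * ?P j n * (real q ^ j * real q powi (int k - int j) - real q ^ j)"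
    unfolding g by (simp add: algebra_simps)
  also have "\<dots> = (real q ^ k - real q ^ j) * num_rank_mats q n k j"
    unfolding pw num_rank_mats_def by (simp only: mult_ac)
  finally show ?thesis by simp
qed

lemma card_carrier_vec_finite:
  assumes "finite (UNIV :: 'a set)"
  shows "finite (carrier_vec n :: 'a vec set) \<and> card (carrier_vec n :: 'a vec set) = CARD('a) ^ n"
proof -
  have "carrier_vec n = vec_of_list ` {xs :: 'a list. set xs \<subseteq> UNIV \<and> length xs = n}"
  proof (intro equalityI subsetI)
    fix v :: "'a vec" assume "v \<in> carrier_vec n"
    then show "v \<in> vec_of_list ` {xs. set xs \<subseteq> UNIV \<and> length xs = n}"
      by (intro image_eqI[of _ _ "list_of_vec v"]) (simp_all add: vec_list)
  next
    fix v :: "'a vec" assume "v \<in> vec_of_list ` {xs. set xs \<subseteq> UNIV \<and> length xs = n}"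
    then show "v \<in> carrier_vec n"
      by (auto intro: carrier_vecI)
  qed
  moreover have "inj_on vec_of_list {xs :: 'a list. set xs \<subseteq> UNIV \<and> length xs = n}"
    by (rule inj_on_inverseI[of _ list_of_vec]) (rule list_vec)
  ultimately show ?thesis
    using card_lists_length_eq[OF assms, of n] finite_lists_length_eq[OF assms, of n]
    by (simp add: card_image)
qed

context vec_space begin

lemma span_insert_eq:
  assumes S: "S \<subseteq> carrier_vec n" "finite S" and v: "v \<in> carrier_vec n" "v \<notin> S"
  shows "span (insert v S) = (\<lambda>(c, w). c \<cdot>\<^sub>v v + w) ` (UNIV \<times> span S)"
proof (intro equalityI subsetI)
  fix x assume "x \<in> span (insert v S)"
  then obtain a where "x = lincomb a (insert v S)"
    using finite_span[of "insert v S"] S v by auto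
  also have "\<dots> = a v \<cdot>\<^sub>v v + lincomb a S"
    using lincomb_insert2[of S a v] S v by simp
  finally show "x \<in> (\<lambda>(c, w). c \<cdot>\<^sub>v v + w) ` (UNIV \<times> span S)"
    using finite_span[of S] S by auto
next
  fix x assume "x \<in> (\<lambda>(c, w). c \<cdot>\<^sub>v v + w) ` (UNIV \<times> span S)"
  then obtain c w where x: "x = c \<cdot>\<^sub>v v + w" "w \<in> span S" by auto
  have sub: "submodule class_ring (span (insert v S)) V"
    using S v by (intro span_is_submodule) auto
  have "v \<in> span (insert v S)"
    using S v by (intro span_mem) auto
  then have "c \<cdot>\<^sub>v v \<in> span (insert v S)"
    using submodule.smult_closed[OF sub, of c v] by simp
  moreover have "w \<in> span (insert v S)"
    using x(2) span_is_monotone[of S "insert v S"] by auto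
  ultimately show "x \<in> span (insert v S)"
    using submodule.m_closed[OF sub] x(1) by simp
qed

lemma card_span_insert:
  assumes fin: "finite (UNIV :: 'a set)"
  assumes S: "S \<subseteq> carrier_vec n" "finite S" and v: "v \<in> carrier_vec n" "v \<notin> span S"
  shows "card (span (insert v S)) = CARD('a) * card (span S)"
proof -
  have sub: "submodule class_ring (span S) V"
    using S by (intro span_is_submodule) auto
  have "inj_on (\<lambda>(c, w). c \<cdot>\<^sub>v v + w) (UNIV \<times> span S)"
  proof (intro inj_onI, clarsimp)
    fix c w c' w' assume w: "w \<in> span S" "w' \<in> span S" and eq: "c \<cdot>\<^sub>v v + w = c' \<cdot>\<^sub>v v + w'"
    have car: "w \<in> carrier_vec n" "w' \<in> carrier_vec n"
      using w S span_closed by auto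
    have "c = c'"
    proof (rule ccontr)
      assume "c \<noteq> c'"
      have "v = inverse (c - c') \<cdot>\<^sub>v (w' + (- 1) \<cdot>\<^sub>v w)"
      proof (rule eq_vecI)
        fix i assume "i < dim_vec (inverse (c - c') \<cdot>\<^sub>v (w' + (- 1) \<cdot>\<^sub>v w))"
        then have i: "i < n" using car by simp
        have "c * v $ i + w $ i = c' * v $ i + w' $ i"
          using arg_cong[OF eq, of "\<lambda>x. x $ i"] i car v by simp
        then have "(c - c') * v $ i = w' $ i - w $ i" by (simp add: algebra_simps)
        then show "v $ i = (inverse (c - c') \<cdot>\<^sub>v (w' + (- 1) \<cdot>\<^sub>v w)) $ i"
          using i car v \<open>c \<noteq> c'\<close> by (simp add: field_simps)
      qed (use car v in auto)
      moreover have "(- 1) \<cdot>\<^sub>v w \<in> span S"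
        using submodule.smult_closed[OF sub, of "- 1" w] w by simp
      then have "w' + (- 1) \<cdot>\<^sub>v w \<in> span S"
        using submodule.m_closed[OF sub, of w' "(- 1) \<cdot>\<^sub>v w"] w by simp
      then have "inverse (c - c') \<cdot>\<^sub>v (w' + (- 1) \<cdot>\<^sub>v w) \<in> span S"
        using submodule.smult_closed[OF sub, of "inverse (c - c')"] by simp
      ultimately show False using v by simp
    qed
    moreover have "w = w'" if "c = c'"
      using eq car v that by (auto simp: vec_eq_iff)
    ultimately show "c = c' \<and> w = w'" by simp
  qed
  moreover have "v \<notin> S" using S v span_mem by auto
  ultimately show ?thesis
    using span_insert_eq[OF S v(1)] by (simp add: card_image card_cartesian_product)
qed

lemma card_span_lin_indpt:
  assumes fin: "finite (UNIV :: 'a set)"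
  assumes "finite U" "U \<subseteq> carrier_vec n" "lin_indpt U"
  shows "card (span U) = CARD('a) ^ card U"
  using assms(2-)
proof (induction U rule: finite_induct)
  case empty
  then show ?case by (simp add: span_empty)
next
  case (insert v U)
  have li: "lin_indpt U"
    using insert.prems(2) by (rule subset_li_is_li) auto
  have "v \<notin> span U"
    using lin_dep_iff_in_span[of U v] insert li by auto
  then show ?case
    using insert li card_span_insert[OF fin, of U v] by simp
qed

lemma card_span_eq_rank:
  assumes fin: "finite (UNIV :: 'a set)"
  assumes A: "A \<in> carrier_mat n nc"
  shows "card (span (set (cols A))) = CARD('a) ^ rank A"
proof -
  let ?S = "set (cols A)"
  have S: "?S \<subseteq> carrier_vec n" using A cols_dim by blast
  have li0: "lin_indpt {}"
    by (metis (no_types) empty_subsetI fin_dim finite_basis_exists subset_li_is_li vec_vs vectorspace.basis_def)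
  obtain U where U: "maximal U (\<lambda>T. T \<subseteq> ?S \<and> lin_indpt T)" "finite U"
    using maximal_exists_superset[of ?S "\<lambda>T. T \<subseteq> ?S \<and> lin_indpt T" "{}"] li0 by auto
  have US: "U \<subseteq> ?S" "lin_indpt U" using U(1) by (auto simp: maximal_def)
  have "s \<in> span U" if "s \<in> ?S" for s
  proof (rule ccontr)
    assume s: "s \<notin> span U"
    then have "s \<notin> U" using US S span_mem[of U s] by auto
    with s have "lin_indpt (U \<union> {s})"
      using lin_dep_iff_in_span[of U s] US S that by auto
    then have "U \<union> {s} = U" using U(1) US that by (auto simp: maximal_def)
    with \<open>s \<notin> U\<close> show False by auto
  qed
  then have "span ?S \<subseteq> span U"
    using US S by (intro span_is_subset span_is_submodule) auto
  moreover have "span U \<subseteq> span ?S" using US by (intro span_is_monotone)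
  ultimately have "span ?S = span U" by blast
  then show ?thesis
    using card_span_lin_indpt[OF fin U(2) _ US(2)] US S rank_card_indpt[OF A U(1)] by simp
qed

lemma card_lists_span:
  assumes fin: "finite (UNIV :: 'a set)"
  shows "real (card {xs. length xs = l \<and> set xs \<subseteq> carrier_vec n \<and> card (span (set xs)) = CARD('a) ^ j})
    = num_rank_mats (CARD('a)) l n j"
proof -
  let ?q = "CARD('a)"
  have q: "?q > 1"
    using fin card_mono[OF fin, of "{0, 1 :: 'a}"] by simp
  have V: "finite (carrier_vec n :: 'a vec set)" "card (carrier_vec n :: 'a vec set) = ?q ^ n"
    using card_carrier_vec_finite[OF fin] by auto
  define L where "L l j = {xs. length xs = l \<and> set xs \<subseteq> carrier_vec n \<and> card (span (set xs)) = ?q ^ j}"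
    for l j
  have finL: "finite (L l j)" for l j
    using finite_lists_length_eq[OF V(1), of l] by (rule rev_finite_subset) (auto simp: L_def)
  have sub: "span (set xs) \<subseteq> carrier_vec n" if "set xs \<subseteq> carrier_vec n" for xs
    using span_closed that by auto
  have finS: "finite (span (set xs))" if "set xs \<subseteq> carrier_vec n" for xs
    using sub[OF that] V(1) by (rule finite_subset)
  define T where "T l j = (SIGMA xs:L l j. span (set xs))" for l j
  define T' where "T' l j = (SIGMA xs:L l j. carrier_vec n - span (set xs))" for l j
  have cT: "card (T l j) = ?q ^ j * card (L l j)" for l j
    unfolding T_def using finL finS by (subst card_SigmaI) (auto simp: L_def)
  have cT': "real (card (T' l j)) = (real ?q ^ n - real ?q ^ j) * card (L l j)" for l j
  proof -
    have "card (carrier_vec n - span (set xs)) = ?q ^ n - ?q ^ j \<and> ?q ^ j \<le> ?q ^ n" if "xs \<in> L l j" for xs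
      using that sub[of xs] finS[of xs] V card_mono[OF V(1) sub[of xs]]
      by (auto simp: L_def card_Diff_subset)
    then have "card (T' l j) = (?q ^ n - ?q ^ j) * card (L l j)" "L l j \<noteq> {} \<Longrightarrow> ?q ^ j \<le> ?q ^ n"
      unfolding T'_def using finL V(1) by (auto simp: card_SigmaI)
    then show ?thesis by (cases "L l j = {}") (auto simp: of_nat_diff)
  qed
  have inj: "inj_on (\<lambda>(xs, v). v # xs) A" for A :: "('a vec list \<times> 'a vec) set"
    by (auto intro: inj_onI)
  have step: "card (span (set (v # xs))) =
      (if v \<in> span (set xs) then card (span (set xs)) else ?q * card (span (set xs)))"
    if "v \<in> carrier_vec n" "set xs \<subseteq> carrier_vec n" for v xs
    using that card_span_insert[OF fin, of "set xs" v] already_in_span[of "set xs" v] by auto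
  have Cons_L: "v # xs \<in> L (Suc l) j \<longleftrightarrow> length xs = l \<and> v \<in> carrier_vec n \<and> set xs \<subseteq> carrier_vec n \<and>
      (if v \<in> span (set xs) then card (span (set xs)) else ?q * card (span (set xs))) = ?q ^ j"
    for v xs l j
    using step[of v xs] unfolding L_def by auto
  have T_iff: "(xs, v) \<in> T l j \<longleftrightarrow> length xs = l \<and> v \<in> carrier_vec n \<and> set xs \<subseteq> carrier_vec n \<and>
      v \<in> span (set xs) \<and> card (span (set xs)) = ?q ^ j" for v xs l j
    using sub[of xs] unfolding T_def L_def by blast
  have T'_iff: "(xs, v) \<in> T' l j \<longleftrightarrow> length xs = l \<and> v \<in> carrier_vec n \<and> set xs \<subseteq> carrier_vec n \<and>
      v \<notin> span (set xs) \<and> card (span (set xs)) = ?q ^ j" for v xs l j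
    unfolding T'_def L_def by blast
  have Cons_L0: "v # xs \<in> L (Suc l) 0 \<longleftrightarrow> (xs, v) \<in> T l 0" for v xs l
    using q unfolding Cons_L T_iff by (cases "v \<in> span (set xs)") simp_all
  have Cons_LS: "v # xs \<in> L (Suc l) (Suc j) \<longleftrightarrow> (xs, v) \<in> T l (Suc j) \<union> T' l j" for v xs l j
    using q unfolding Cons_L Un_iff T_iff T'_iff by (cases "v \<in> span (set xs)") simp_all
  have image: "L (Suc l) j = (\<lambda>(xs, v). v # xs) ` A"
    if A: "\<And>v xs. v # xs \<in> L (Suc l) j \<longleftrightarrow> (xs, v) \<in> A" for l j A
  proof (intro equalityI subsetI)
    fix ys assume ys: "ys \<in> L (Suc l) j"
    then obtain v xs where "ys = v # xs" by (cases ys) (auto simp: L_def)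
    with ys A show "ys \<in> (\<lambda>(xs, v). v # xs) ` A" by force
  qed (use A in auto)
  have L0: "card (L (Suc l) 0) = card (T l 0)" for l
    by (subst image[OF Cons_L0]) (rule card_image[OF inj])
  have LS: "card (L (Suc l) (Suc j)) = card (T l (Suc j) \<union> T' l j)" for l j
    by (subst image[OF Cons_LS]) (rule card_image[OF inj])
  have dj: "T l (Suc j) \<inter> T' l j = {}" for l j
    by (auto simp: T_def T'_def)
  have finT: "finite (T l j)" "finite (T' l j)" for l j
    unfolding T_def T'_def using finL finS V(1) by (auto intro!: finite_SigmaI simp: L_def)
  have "real (card (L l j)) = num_rank_mats ?q l n j" for l j
  proof (induction l arbitrary: j)
    case 0
    have "L 0 j = (if j = 0 then {[]} else {})"
      using one_less_power[OF q, of j] by (auto simp: L_def span_empty)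
    then show ?case
      by (cases j) (simp_all add: num_rank_mats_0 num_rank_mats_dim_0)
  next
    case (Suc l)
    show ?case
    proof (cases j)
      case 0
      then show ?thesis
        using Suc.IH[of 0] cT[of l 0] by (simp add: L0 num_rank_mats_0)
    next
      case (Suc i)
      then show ?thesis
        using Suc.IH[of "Suc i"] Suc.IH[of i] cT[of l "Suc i"] cT'[of l i] finT dj q
        by (simp add: LS card_Un_disjoint num_rank_mats_Suc)
    qed
  qed
  then show ?thesis by (simp add: L_def)
qed

end

text \<open>The closed formula above is the number of \<open>k \<times> n\<close> matrices of rank \<open>j\<close>.\<close>

theorem card_rank_mats:
  "real (card {M :: 'a::finite_field mat. M \<in> carrier_mat k n \<and> vec_space.rank k M = j})
    = num_rank_mats (CARD('a)) n k j"
proof -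
  interpret vec_space "TYPE('a)" k .
  let ?q = "CARD('a)"
  have q: "?q > 1" using card_mono[of UNIV "{0, 1 :: 'a}"] by simp
  have "bij_betw cols {M :: 'a mat. M \<in> carrier_mat k n \<and> rank M = j}
     {xs. length xs = n \<and> set xs \<subseteq> carrier_vec k \<and> card (span (set xs)) = ?q ^ j}"
  proof (rule bij_betwI[where g = "mat_of_cols k"])
    show "cols \<in> {M :: 'a mat. M \<in> carrier_mat k n \<and> rank M = j} \<rightarrow>
        {xs. length xs = n \<and> set xs \<subseteq> carrier_vec k \<and> card (span (set xs)) = ?q ^ j}"
      using card_span_eq_rank by (auto dest: cols_dim[THEN subsetD])
    show "mat_of_cols k \<in> {xs. length xs = n \<and> set xs \<subseteq> carrier_vec k \<and> card (span (set xs)) = ?q ^ j} \<rightarrow>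
        {M :: 'a mat. M \<in> carrier_mat k n \<and> rank M = j}"
    proof safe
      fix xs :: "'a vec list"
      assume "set xs \<subseteq> carrier_vec k" "card (span (set xs)) = ?q ^ j"
      then have "?q ^ rank (mat_of_cols k xs) = ?q ^ j"
        using card_span_eq_rank[of "mat_of_cols k xs" "length xs"] by simp
      then show "rank (mat_of_cols k xs) = j"
        using q by simp
    qed auto
    show "mat_of_cols k (cols M) = M" if "M \<in> {M :: 'a mat. M \<in> carrier_mat k n \<and> rank M = j}" for M
      using that mat_of_cols_cols[of M] by auto
    show "cols (mat_of_cols k xs) = xs"
      if "xs \<in> {xs. length xs = n \<and> set xs \<subseteq> carrier_vec k \<and> card (span (set xs)) = ?q ^ j}" for xs
      using that by simp
  qed
  from bij_betw_same_card[OF this] show ?thesis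
    by (simp only: card_lists_span finite)
qed

end

theory Submission
  imports Defs
begin

text \<open>
  In characteristic \<open>p\<close> the map \<open>x \<mapsto> x ^ (p ^ l)\<close> is additive, so the \<open>i\<close>-th component of a point
  of the neuromanifold is \<open>\<Sum>t. C $$ (i, t) \<cdot> x\<^sub>t ^ r\<close>, where \<open>C\<close> is the product of \<open>B\<close> with the entrywise
  \<open>r\<close>-th power of \<open>A\<close>. As the Frobenius map permutes a finite field, \<open>C\<close> runs through all products of
  a \<open>k \<times> m\<close> and an \<open>m \<times> n\<close> matrix, that is, through all \<open>k \<times> n\<close> matrices of rank at most \<open>m\<close>.
  The minimum in the formula is always attained by the second argument.
\<close>

section \<open>Matrix products and bounded rank\<close>

lemma (in vec_space) rank_mult_le:
  assumes B: "B \<in> carrier_mat n m" and A: "A \<in> carrier_mat m nc"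
  shows "rank (B * A) \<le> rank B"
proof -
  let ?W = "span (set (cols B))" and ?X = "span (set (cols (B * A)))"
  have BA: "B * A \<in> carrier_mat n nc" using B A by simp
  have car: "set (cols B) \<subseteq> carrier_vec n" "set (cols (B * A)) \<subseteq> carrier_vec n"
    using cols_dim[of B] cols_dim[of "B * A"] B by auto
  have "set (cols (B * A)) \<subseteq> ?W"
  proof
    fix v assume "v \<in> set (cols (B * A))"
    then obtain j where "j < nc" "v = col (B * A) j"
      using A by (auto simp: cols_def)
    then have "v = B *\<^sub>v col A j" "col A j \<in> carrier_vec m"
      using A B by (auto simp: mult_mat_vec_def)
    then show "v \<in> ?W"
      using col_space_eq[OF B] B unfolding col_space_def by auto
  qed
  then have "?X \<subseteq> ?W"
    using car by (intro span_subsetI)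
  moreover have W: "subspace class_ring ?W V" and X: "subspace class_ring ?X V"
    using car span_is_subspace by auto
  \<comment> \<open>\<open>?X\<close> is viewed inside \<open>?W\<close> instead of the whole space,
    so that its dimension is bounded by that of \<open>?W\<close>, which is
    \<open>rank B\<close>.\<close>
  ultimately have "subspace class_ring ?X (vs ?W)"
    using nested_subspaces by blast
  then show ?thesis
    unfolding rank_def
    using vectorspace.subspace_dim[OF subspace_is_vs[OF W]] fin_dim_span_cols[OF B]
      fin_dim_span_cols[OF BA] by auto
qed

text \<open>The columns of \<open>B\<close> are a basis of the column space of \<open>M\<close>,
  padded with zeros; column \<open>j\<close> of \<open>A\<close> holds coefficients that express
  column \<open>j\<close> of \<open>M\<close> in them.\<close>

lemma (in vec_space) rank_factorization:
  assumes M: "M \<in> carrier_mat n nc" and "rank M \<le> m"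
  obtains B A where "B \<in> carrier_mat n m" "A \<in> carrier_mat m nc" "M = B * A"
proof -
  let ?S = "set (cols M)"
  have S: "?S \<subseteq> carrier_vec n" using M cols_dim by blast
  have sub: "subspace class_ring (span ?S) V" using S span_is_subspace by auto
  interpret W: vectorspace class_ring "span_vs ?S" by (rule subspace_is_vs[OF sub])
  obtain U where U: "finite U" "W.basis U"
    using W.finite_basis_exists fin_dim_span_cols[OF M] by auto
  have US: "U \<subseteq> span ?S" using U(2) by (auto simp: W.basis_def)
  have "card U = rank M"
    unfolding rank_def using W.dim_basis[OF U] by simp
  \<comment> \<open>A basis of the column space spans it within that subspace; spans taken there and
    in the ambient space agree.\<close>
  have spanU: "span U = span ?S"
    using span_li_not_depend(1)[OF US] sub U(2) by (simp add: W.basis_def subspace_def)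
  obtain us where us: "set us = U" "distinct us"
    using finite_distinct_list[OF U(1)] by auto
  \<comment> \<open>As \<open>rank M \<le> m\<close>, the subtraction is not truncated, and the zero
    vectors bring the number of columns to exactly \<open>m\<close>.\<close>
  define ys where "ys = us @ replicate (m - rank M) (0\<^sub>v n)"
  have len: "length ys = m"
    using us \<open>card U = rank M\<close> assms(2) by (simp add: ys_def distinct_card[symmetric])
  have Ucar: "U \<subseteq> carrier_vec n" using US S span_closed by auto
  have ys: "set ys \<subseteq> carrier_vec n" "U \<subseteq> set ys"
    using Ucar us by (auto simp: ys_def)
  define B where "B = mat_of_cols n ys"
  have B: "B \<in> carrier_mat n m" "set (cols B) = set ys"
    using ys len by (auto simp: B_def)
  have "\<exists>x\<in>carrier_vec m. B *\<^sub>v x = col M j" if "j < nc" for j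
  proof -
    have "col M j \<in> ?S" using that M by (auto simp: cols_def)
    then have "col M j \<in> span U" using spanU S span_mem by auto
    then have "col M j \<in> col_space B"
      using span_is_monotone[OF ys(2)] by (auto simp: col_space_def B)
    then show ?thesis using col_space_eq[OF B(1)] B(1) by auto
  qed
  then obtain x where x: "\<And>j. j < nc \<Longrightarrow> x j \<in> carrier_vec m" "\<And>j. j < nc \<Longrightarrow> B *\<^sub>v x j = col M j"
    by metis
  define A where "A = mat_of_cols m (map x [0..<nc])"
  have A: "A \<in> carrier_mat m nc" unfolding A_def by (rule carrier_matI) auto
  have "M = B * A"
  proof (rule mat_col_eqI)
    fix j assume "j < dim_col (B * A)"
    then have j: "j < nc" using A by simp
    then have "col A j = x j" using x by (simp add: A_def)
    then have "col (B * A) j = B *\<^sub>v x j"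
      using j A by (simp add: col_mult2[OF B(1) A])
    then show "col M j = col (B * A) j" using x j by simp
  qed (use M A B in auto)
  with A B that show thesis by blast
qed

text \<open>Replaces pairs of factors, which are far from unique, by a rank condition that can be
  counted.\<close>

lemma products_eq_rank_le:
  "{B * A | A B. A \<in> carrier_mat m n \<and> B \<in> carrier_mat k m} =
    {M :: 'a::field mat. M \<in> carrier_mat k n \<and> vec_space.rank k M \<le> m}"
proof -
  interpret vec_space "TYPE('a)" k .
  show ?thesis
  proof (intro equalityI subsetI)
    fix M :: "'a mat" assume "M \<in> {B * A | A B. A \<in> carrier_mat m n \<and> B \<in> carrier_mat k m}"
    then obtain A B where AB: "M = B * A" "A \<in> carrier_mat m n" "B \<in> carrier_mat k m" by blast
    then have "rank M \<le> m"
      using rank_mult_le[OF AB(3,2)] rank_le_nc[OF AB(3)] by simp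
    with AB show "M \<in> {M. M \<in> carrier_mat k n \<and> rank M \<le> m}" by auto
  next
    fix M :: "'a mat" assume "M \<in> {M. M \<in> carrier_mat k n \<and> rank M \<le> m}"
    then have "M \<in> carrier_mat k n" "rank M \<le> m" by auto
    then show "M \<in> {B * A | A B. A \<in> carrier_mat m n \<and> B \<in> carrier_mat k m}"
      by (rule rank_factorization) blast
  qed
qed

section \<open>Counting matrices of bounded rank\<close>

lemma finite_carrier_mat: "finite (carrier_mat k n :: 'a::finite mat set)"
  and card_carrier_mat_le: "card (carrier_mat k n :: 'a::finite mat set) \<le> CARD('a) ^ (k * n)"
proof -
  let ?L = "{xs :: 'a vec list. set xs \<subseteq> carrier_vec k \<and> length xs = n}"
  have V: "finite (carrier_vec k :: 'a vec set)" "card (carrier_vec k :: 'a vec set) = CARD('a) ^ k"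
    using card_carrier_vec_finite[where 'a = 'a] by auto
  have L: "finite ?L" "card ?L = CARD('a) ^ (k * n)"
    using finite_lists_length_eq[OF V(1)] card_lists_length_eq[OF V(1)] V(2)
    by (simp_all add: power_mult)
  have inj: "inj_on cols (carrier_mat k n :: 'a mat set)"
    by (rule inj_on_inverseI[of _ "mat_of_cols k"]) auto
  have im: "cols ` (carrier_mat k n :: 'a mat set) \<subseteq> ?L"
    by (auto dest: cols_dim[THEN subsetD])
  show "finite (carrier_mat k n :: 'a mat set)"
    by (rule inj_on_finite[OF inj im L(1)])
  show "card (carrier_mat k n :: 'a mat set) \<le> CARD('a) ^ (k * n)"
    using card_inj_on_le[OF inj im L(1)] L(2) by simp
qed

lemma card_rank_le_mats:
  "real (card {M :: 'a::finite_field mat. M \<in> carrier_mat k n \<and> vec_space.rank k M \<le> m}) =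
    (\<Sum>j=1..m. num_rank_mats (CARD('a)) n k j) + 1"
proof -
  let ?R = "\<lambda>j. {M :: 'a mat. M \<in> carrier_mat k n \<and> vec_space.rank k M = j}"
  have "{M :: 'a mat. M \<in> carrier_mat k n \<and> vec_space.rank k M \<le> m} = (\<Union>j\<in>{..m}. ?R j)"
    by auto
  moreover have "card (\<Union>j\<in>{..m}. ?R j) = (\<Sum>j\<le>m. card (?R j))"
    by (intro card_UN_disjoint) (auto intro: finite_subset[OF _ finite_carrier_mat])
  ultimately have "real (card {M :: 'a mat. M \<in> carrier_mat k n \<and> vec_space.rank k M \<le> m}) =
      (\<Sum>j\<le>m. num_rank_mats (CARD('a)) n k j)"
    by (simp add: card_rank_mats)
  \<comment> \<open>The term for rank 0 counts only the zero matrix and becomes the summand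
    1.\<close>
  also have "\<dots> = num_rank_mats (CARD('a)) n k 0 + (\<Sum>j=1..m. num_rank_mats (CARD('a)) n k j)"
    by (simp add: atMost_atLeast0 sum.atLeast_Suc_atMost)
  finally show ?thesis
    by (simp add: num_rank_mats_0)
qed

section \<open>Characteristic and the Frobenius map\<close>

lemma CHAR_poly_mapping: "CHAR('m::monoid_add \<Rightarrow>\<^sub>0 'a::semiring_1) = CHAR('a)"
proof (rule CHAR_eqI)
  \<comment> \<open>\<open>of_nat c\<close> is the constant polynomial with coefficient
    \<open>of_nat c\<close>, so it vanishes in both rings or in neither.\<close>
  have iff: "(of_nat c :: 'm \<Rightarrow>\<^sub>0 'a) = 0 \<longleftrightarrow> (of_nat c :: 'a) = 0" for c
    unfolding single_of_nat[symmetric] by (metis lookup_single_eq single_zero)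
  show "(of_nat CHAR('a) :: 'm \<Rightarrow>\<^sub>0 'a) = 0"
    unfolding iff by simp
  show "CHAR('a) dvd c" if "(of_nat c :: 'm \<Rightarrow>\<^sub>0 'a) = 0" for c
    using that unfolding iff by (simp add: of_nat_eq_0_iff_char_dvd)
qed

text \<open>On a finite set injectivity suffices, and additivity reduces it to the fact that only 0
  has \<open>r\<close>-th power 0.\<close>

lemma surj_frobenius_power:
  assumes "r = CHAR('a::finite_field) ^ l"
  shows "surj (\<lambda>x :: 'a. x ^ r)"
proof (rule finite_UNIV_inj_surj)
  have r: "r > 0" using assms by simp
  show "inj (\<lambda>x :: 'a. x ^ r)"
  proof (rule injI)
    fix x y :: 'a assume "x ^ r = y ^ r"
    moreover have "x ^ r = (x - y) ^ r + y ^ r"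
      using freshmans_dream'[OF CHAR_prime assms, of "x - y" y] by simp
    ultimately have "(x - y) ^ r = 0" by simp
    then show "x = y" by simp
  qed
qed simp

section \<open>Linear combinations of powers of the variables\<close>

lemma mconst_add: "mconst (a + b) = mconst a + mconst b"
  by (simp add: mconst_def single_add)

lemma mconst_mult: "mconst (a * b) = mconst a * mconst b"
  by (simp add: mconst_def mult_single)

lemma mconst_sum: "mconst (sum f S) = (\<Sum>s\<in>S. mconst (f s))"
  by (induction S rule: infinite_finite_induct) (simp_all add: mconst_add, simp_all add: mconst_def)

lemma mconst_power: "mconst a ^ r = mconst (a ^ r)"
  by (induction r) (simp_all add: mconst_mult, simp add: mconst_def)

lemma mvar_power: "mvar t ^ r = Poly_Mapping.single (Poly_Mapping.single t r) 1"
  by (induction r) (simp_all add: mvar_def mult_single flip: single_add)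

text \<open>Normal form of the components of a point; only the values of \<open>c\<close> below
  \<open>n\<close> matter.\<close>

definition power_form :: "nat \<Rightarrow> nat \<Rightarrow> (nat \<Rightarrow> 'a) \<Rightarrow> 'a::comm_ring_1 mpoly"
  where "power_form n r c = (\<Sum>t<n. mconst (c t) * mvar t ^ r)"

text \<open>For \<open>r > 0\<close> the \<open>r\<close>-th powers of distinct variables are
  distinct monomials; for \<open>r = 0\<close> they would all be 1.\<close>

lemma lookup_power_form:
  assumes "r > 0" "t < n"
  shows "Poly_Mapping.lookup (power_form n r c) (Poly_Mapping.single t r) = c t"
proof -
  have "Poly_Mapping.single s r = Poly_Mapping.single t r \<longleftrightarrow> s = t" for s
    using assms(1) by (metis lookup_single_eq lookup_single_not_eq neq0_conv)
  then have "Poly_Mapping.lookup (power_form n r c) (Poly_Mapping.single t r) = (\<Sum>s<n. if s = t then c s else 0)"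
    unfolding power_form_def lookup_sum mvar_power mconst_def
    by (intro sum.cong) (auto simp: mult_single lookup_single when_def)
  then show ?thesis using assms(2) by simp
qed

text \<open>The entries of the matrix are coefficients of the polynomials, so counting tuples
  amounts to counting matrices.\<close>

lemma inj_on_power_forms:
  assumes "r > 0"
  shows "inj_on (\<lambda>C. vec k (\<lambda>i. power_form n r (\<lambda>t. C $$ (i, t)))) (carrier_mat k n)"
proof (rule inj_onI)
  fix C D :: "'a mat"
  assume CD: "C \<in> carrier_mat k n" "D \<in> carrier_mat k n"
    and eq: "vec k (\<lambda>i. power_form n r (\<lambda>t. C $$ (i, t))) = vec k (\<lambda>i. power_form n r (\<lambda>t. D $$ (i, t)))"
  show "C = D"
  proof (rule eq_matI)
    fix i t assume "i < dim_row D" "t < dim_col D"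
    then have it: "i < k" "t < n" using CD by auto
    have "power_form n r (\<lambda>t. C $$ (i, t)) = power_form n r (\<lambda>t. D $$ (i, t))"
      using arg_cong[OF eq, of "\<lambda>v. v $ i"] it by simp
    then show "C $$ (i, t) = D $$ (i, t)"
      using lookup_power_form[OF assms it(2)] by metis
  qed (use CD in auto)
qed

section \<open>The neuromanifold as an image of matrix products\<close>

lemma linear_form_power:
  fixes a :: "nat \<Rightarrow> 'a::finite_field"
  assumes "r = CHAR('a) ^ l"
  shows "(\<Sum>t<n. mconst (a t) * mvar t) ^ r = power_form n r (\<lambda>t. a t ^ r)"
proof -
  \<comment> \<open>The polynomial ring has the prime characteristic of its coefficient field, so
    \<open>r\<close>-th powers are additive there too.\<close>
  have "(\<Sum>t<n. mconst (a t) * mvar t) ^ r = (\<Sum>t<n. (mconst (a t) * mvar t) ^ r)"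
    by (rule freshmans_dream_sum'[where n = l]) (simp_all add: CHAR_poly_mapping assms)
  then show ?thesis
    by (simp add: power_form_def power_mult_distrib mconst_power)
qed

text \<open>With \<open>b\<close> a row of one matrix and \<open>c\<close> the entries of another,
  the new coefficients form a row of their product.\<close>

lemma sum_mconst_power_form:
  "(\<Sum>s\<in>S. mconst (b s) * power_form n r (c s)) = power_form n r (\<lambda>t. \<Sum>s\<in>S. b s * c s t)"
  unfolding power_form_def sum_distrib_left
  by (subst sum.swap) (simp add: mconst_sum mconst_mult sum_distrib_right mult.assoc)

lemma neuromanifold_eq_image:
  assumes r: "r = CHAR('a::finite_field) ^ l"
  shows "(neuromanifold n m k r :: 'a mpoly vec set) =
    (\<lambda>C. vec k (\<lambda>i. power_form n r (\<lambda>t. C $$ (i, t)))) `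
      {B * A | A B. A \<in> carrier_mat m n \<and> B \<in> carrier_mat k m}"
    (is "_ = ?f ` ?P")
proof -
  have point: "vec k (\<lambda>i. \<Sum>s<m. mconst (B $$ (i, s)) * (\<Sum>t<n. mconst (A $$ (s, t)) * mvar t) ^ r) =
      ?f (B * map_mat (\<lambda>x. x ^ r) A)"
    if "A \<in> carrier_mat m n" "B \<in> carrier_mat k m" for A B :: "'a mat"
  proof (rule eq_vecI; clarsimp)
    fix i assume i: "i < k"
    have "(B * map_mat (\<lambda>x. x ^ r) A) $$ (i, t) = (\<Sum>s<m. B $$ (i, s) * A $$ (s, t) ^ r)" if "t < n" for t
      using that i \<open>A \<in> _\<close> \<open>B \<in> _\<close> by (simp add: scalar_prod_def atLeast0LessThan)
    then show "(\<Sum>s<m. mconst (B $$ (i, s)) * (\<Sum>t<n. mconst (A $$ (s, t)) * mvar t) ^ r) =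
        power_form n r (\<lambda>t. (B * map_mat (\<lambda>x. x ^ r) A) $$ (i, t))"
      \<comment> \<open>The entry formula is known only for \<open>t < n\<close>; unfolding
        \<open>power_form\<close> brings that range into view.\<close>
      unfolding linear_form_power[OF r] sum_mconst_power_form by (simp add: power_form_def)
  qed
  \<comment> \<open>Entrywise \<open>r\<close>-th roots exist because the Frobenius power is
    surjective; they turn an arbitrary left-over factor \<open>A\<close> into weights
    \<open>A'\<close>.\<close>
  have root: "\<exists>A' \<in> carrier_mat m n. map_mat (\<lambda>x. x ^ r) A' = A" if "A \<in> carrier_mat m n" for A :: "'a mat"
  proof
    let ?g = "inv_into UNIV (\<lambda>x :: 'a. x ^ r)"
    show "map_mat (\<lambda>x. x ^ r) (map_mat ?g A) = A"
      using surj_f_inv_f[OF surj_frobenius_power[OF r]] by (intro eq_matI) auto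
  qed (use that in simp)
  show ?thesis
  proof (intro equalityI subsetI)
    fix v :: "'a mpoly vec" assume "v \<in> neuromanifold n m k r"
    then obtain A B where AB: "A \<in> carrier_mat m n" "B \<in> carrier_mat k m"
      and v: "v = vec k (\<lambda>i. \<Sum>s<m. mconst (B $$ (i, s)) * (\<Sum>t<n. mconst (A $$ (s, t)) * mvar t) ^ r)"
      unfolding neuromanifold_def by blast
    have "map_mat (\<lambda>x. x ^ r) A \<in> carrier_mat m n" using AB by simp
    then have "B * map_mat (\<lambda>x. x ^ r) A \<in> ?P" using AB(2) by blast
    then show "v \<in> ?f ` ?P" unfolding v point[OF AB] by (rule imageI)
  next
    fix v assume "v \<in> ?f ` ?P"
    then obtain A B where AB: "A \<in> carrier_mat m n" "B \<in> carrier_mat k m" and v: "v = ?f (B * A)"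
      by blast
    obtain A' where A': "A' \<in> carrier_mat m n" "map_mat (\<lambda>x. x ^ r) A' = A"
      using root[OF AB(1)] by blast
    show "v \<in> neuromanifold n m k r"
      unfolding v neuromanifold_def A'(2)[symmetric] point[OF A'(1) AB(2), symmetric]
      by (intro CollectI exI conjI, rule refl) (use A'(1) AB(2) in auto)
  qed
qed

theorem corollary5p3p1:
  fixes n m k l p q r :: nat
  assumes "q = CARD('a::finite_field)" and "p = CHAR('a)"
    and "n > 0" and "m > 0" and "k > 0" and "l > 0"
    and "r = p ^ l"
  shows "real (card (neuromanifold n m k r :: 'a mpoly vec set)) =
    min (real q ^ (k * n)) ((\<Sum>j=1..m. num_rank_mats q n k j) + 1)"
proof -
  let ?R = "{M :: 'a mat. M \<in> carrier_mat k n \<and> vec_space.rank k M \<le> m}"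
  have r: "r = CHAR('a) ^ l" "r > 0" using assms by auto
  have "card (neuromanifold n m k r :: 'a mpoly vec set) = card ?R"
    unfolding neuromanifold_eq_image[OF r(1)] products_eq_rank_le
    by (intro card_image inj_on_subset[OF inj_on_power_forms[OF r(2)]]) auto
  \<comment> \<open>This bound by the number of all \<open>k \<times> n\<close> matrices decides the
    minimum.\<close>
  moreover have "card ?R \<le> q ^ (k * n)"
    using card_mono[OF finite_carrier_mat, of ?R k n] card_carrier_mat_le[of k n, where 'a = 'a] assms(1)
    by fastforce
  then have "real (card ?R) \<le> real q ^ (k * n)"
    by (metis of_nat_le_iff of_nat_power)
  ultimately show ?thesis
    using card_rank_le_mats[of k n m, where 'a = 'a] assms(1) by simp
qed

end
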